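(* Let $K \subset \mathbb{R}^d$ be a convex body and let $O$ be an interior point of $K$. Let $X, X'$ be independent uniformly distributed random points in $K$, and let $Y_O$ be a random point, independent of $X$, having the projective distribution on $\partial K$ with centre of projection $O$. Then: 1. For every real $n \ge 1$, $$\mathbb{E}|XX'|^n = \frac{2d}{n+2d}\,\mathbb{E}|XY_O|^n.$$ 2. For every real $t \ne 0$, $$\mathbb{E}\exp(it|XY_O|) = \frac{\frac{d}{dt}\bigl[t^{2d}\,\mathbb{E}\exp(it|XX'|)\bigr]}{2d\,t^{2d-1}}.$$ 3. For every real $n \ge 1$, $$\mathbb{E}|OX|^n = \frac{d}{n+d}\,\mathbb{E}|OY_O|^n,$$ and for every real $t \ne 0$, $$\mathbb{E}\exp(it|OY_O|) = \frac{\frac{d}{dt}\bigl[t^{d}\,\mathbb{E}\exp(it|OX|)\bigr]}{d\,t^{d-1}}.$$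
   Context: A convex body is a convex compact set with non-empty interior. "Uniform in $K$" is with respect to Lebesgue measure. $|AB|$ denotes Euclidean distance. Projective distribution with centre $O$: for an interior point $O$ of $K$, it is the distribution of the random boundary point obtained by taking a uniformly distributed random point $Z$ in $K$ and projecting it from $O$ onto $\partial K$, i.e. replacing $Z \ne O$ by the unique point where the ray from $O$ through $Z$ meets $\partial K$. In the fractions, $\frac{d}{dt}$ denotes differentiation in $t$, while $d$ elsewhere is the dimension. *)

theory Defs
  imports "HOL-Probability.Probability"
begin

definition convex_body :: "'a::euclidean_space set \<Rightarrow> bool" where
  "convex_body K \<longleftrightarrow> convex K \<and> compact K \<and> interior K \<noteq> {}"

text \<open>For a convex body \<open>K\<close>, \<open>c \<in> interior K\<close> and \<open>z \<noteq> c\<close>, exactly one point of the open ray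
  from \<open>c\<close> through \<open>z\<close> lies on the boundary. The value at \<open>z = c\<close> is unspecified; the single
  point \<open>c\<close> is a Lebesgue null set, so it does not affect \<open>projective_distribution\<close>.\<close>

definition radial_projection :: "'a::euclidean_space set \<Rightarrow> 'a \<Rightarrow> 'a \<Rightarrow> 'a" where
  "radial_projection K c z = (THE y. y \<in> frontier K \<and> (\<exists>r>0. y = c + r *\<^sub>R (z - c)))"

text \<open>The law of the projected point, as a Borel measure on the whole space: it is concentrated
  on \<open>frontier K\<close>.\<close>

definition projective_distribution :: "'a::euclidean_space set \<Rightarrow> 'a \<Rightarrow> 'a measure" where
  "projective_distribution K c = distr (uniform_measure lborel K) borel (radial_projection K c)"

end

theory Submission
  imports Defs
begin

text \<open>Let \<open>\<rho>\<close> be the Minkowski gauge of the body about \<open>c\<close>. For a uniform point \<open>Z\<close> the radius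
  \<open>R = \<rho>(Z)\<close> and the projected point \<open>Y\<close> are independent and \<open>R\<close> has density \<open>d r\<^sup>d\<^sup>-\<^sup>1\<close> on \<open>[0, 1]\<close>,
  by scaling of Lebesgue measure. As \<open>Z = c + R (Y - c)\<close>, the distance \<open>|cZ|\<close> has the law of \<open>R |cY|\<close>.
  For two independent uniform points \<open>X\<close>, \<open>X'\<close>, let \<open>X'\<close> be the one with the larger gauge \<open>R\<close>, at the cost
  of a factor \<open>2\<close>. Restricting \<open>X\<close> to the homothetic copy of the body with ratio \<open>R\<close> costs a factor \<open>R\<^sup>d\<close>,
  and after rescaling by \<open>R\<close> the distance becomes \<open>R |XY|\<close>; so \<open>|XX'|\<close> has the law of \<open>S |XY|\<close> with \<open>S\<close>
  independent of density \<open>2 r\<^sup>d \<cdot> d r\<^sup>d\<^sup>-\<^sup>1 = 2d r\<^sup>2\<^sup>d\<^sup>-\<^sup>1\<close>. Moments and characteristic functions of such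
  mixtures are computed by integration in \<open>r\<close>, the latter with the fundamental theorem of calculus.\<close>

text \<open>The case \<open>z = c\<close> is separate because \<open>radial_projection K c c\<close> is unspecified.\<close>

definition gauge_about :: "'a::euclidean_space set \<Rightarrow> 'a \<Rightarrow> 'a \<Rightarrow> real" where
  "gauge_about K c z = (if z = c then 0 else norm (z - c) / norm (radial_projection K c z - c))"

text \<open>For k \<ge> 1 this is the Beta law with parameters k and 1, the law of the maximum of k
  independent uniform points of the unit interval.\<close>

definition power_density :: "nat \<Rightarrow> real measure" where
  "power_density k = density lborel (\<lambda>r. ennreal (indicator {0..1} r * (real k * r ^ (k - 1))))"

section \<open>Homotheties about the centre\<close>

text \<open>Both points span the same open ray from \<open>c\<close>, so the two definite
  descriptions have equivalent conditions. This also covers the unspecified value at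
  \<open>z = c\<close>.\<close>

lemma radial_projection_scale:
  assumes "0 < s"
  shows "radial_projection K c (c + s *\<^sub>R (z - c)) = radial_projection K c z"
proof -
  have "(\<exists>r>0. y = c + r *\<^sub>R (s *\<^sub>R (z - c))) \<longleftrightarrow> (\<exists>r>0. y = c + r *\<^sub>R (z - c))" for y
  proof
    assume "\<exists>r>0. y = c + r *\<^sub>R (s *\<^sub>R (z - c))"
    then obtain r where "r > 0" "y = c + r *\<^sub>R (s *\<^sub>R (z - c))" by blast
    then show "\<exists>r>0. y = c + r *\<^sub>R (z - c)"
      using assms by (intro exI[of _ "r * s"]) simp
  next
    assume "\<exists>r>0. y = c + r *\<^sub>R (z - c)"
    then obtain r where "r > 0" "y = c + r *\<^sub>R (z - c)" by blast
    then show "\<exists>r>0. y = c + r *\<^sub>R (s *\<^sub>R (z - c))"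
      using assms by (intro exI[of _ "r / s"]) simp
  qed
  then show ?thesis
    by (simp add: radial_projection_def)
qed

lemma gauge_about_nonneg [simp]: "0 \<le> gauge_about K c z"
  by (simp add: gauge_about_def)

lemma gauge_about_center [simp]: "gauge_about K c c = 0"
  by (simp add: gauge_about_def)

lemma gauge_about_scale:
  assumes "0 \<le> s"
  shows "gauge_about K c (c + s *\<^sub>R (z - c)) = s * gauge_about K c z"
proof (cases "s = 0")
  case False
  with assms show ?thesis
    by (simp add: gauge_about_def radial_projection_scale)
qed simp

lemma nn_integral_lborel_affine:
  fixes c :: "'a::euclidean_space" and f :: "'a \<Rightarrow> ennreal"
  assumes [measurable]: "f \<in> borel_measurable borel" and "0 < r"
  shows "(\<integral>\<^sup>+x. f x \<partial>lborel) = ennreal (r ^ DIM('a)) * (\<integral>\<^sup>+x. f (c + r *\<^sub>R (x - c)) \<partial>lborel)"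
proof -
  \<comment> \<open>The homothety is written as scaling by \<open>r\<close> followed by translation
    by \<open>c - r *\<^sub>R c\<close>, the form in which \<open>lborel_affine\<close> supplies the
    Jacobian.\<close>
  have "(\<integral>\<^sup>+x. f x \<partial>lborel)
      = (\<integral>\<^sup>+x. f x \<partial>density (distr lborel borel (\<lambda>x. (c - r *\<^sub>R c) + r *\<^sub>R x)) (\<lambda>_. \<bar>r\<bar> ^ DIM('a)))"
    using assms(2) by (subst lborel_affine[of r "c - r *\<^sub>R c"]) auto
  also have "\<dots> = ennreal (r ^ DIM('a)) * (\<integral>\<^sup>+x. f ((c - r *\<^sub>R c) + r *\<^sub>R x) \<partial>lborel)"
    using assms(2) by (simp add: nn_integral_density nn_integral_distr nn_integral_cmult)
  finally show ?thesis
    by (simp add: algebra_simps)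
qed

section \<open>Power densities on the unit interval and averages against them\<close>

lemma sets_power_density [measurable_cong, simp]: "sets (power_density k) = sets borel"
  by (simp add: power_density_def)

lemma space_power_density [simp]: "space (power_density k) = UNIV"
  by (simp add: power_density_def)

lemma emeasure_power_density_Icc:
  assumes "0 < k" "0 \<le> a" "a \<le> 1"
  shows "emeasure (power_density k) {a..1} = ennreal (1 - a ^ k)"
proof -
  have "emeasure (power_density k) {a..1}
      = (\<integral>\<^sup>+r. ennreal (real k * r ^ (k - 1)) * indicator {a..1} r \<partial>lborel)"
    unfolding power_density_def using assms
    by (subst emeasure_density) (auto intro!: nn_integral_cong split: split_indicator)
  also have "\<dots> = ennreal (1 ^ k - a ^ k)"
    using assms by (intro nn_integral_FTC_Icc) (auto intro!: derivative_eq_intros)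
  finally show ?thesis by simp
qed

lemma AE_power_density: "AE r in power_density k. 0 < r \<and> r \<le> 1"
proof -
  have "AE r in lborel. r \<noteq> (0::real)" by (rule AE_lborel_singleton)
  then show ?thesis
    unfolding power_density_def by (subst AE_density) (auto elim!: eventually_mono split: split_indicator)
qed

lemma emeasure_power_density_singleton: "emeasure (power_density k) {x} = 0"
proof -
  have "{x} \<in> null_sets (power_density k)"
    unfolding power_density_def
    using AE_lborel_singleton[of x] by (subst null_sets_density_iff) (auto simp: frequently_def)
  then show ?thesis by auto
qed

lemma nn_integral_power_density:
  assumes [measurable]: "f \<in> borel_measurable borel"
  shows "(\<integral>\<^sup>+r. f r \<partial>power_density k)
       = (\<integral>\<^sup>+r. ennreal (indicator {0..1} r * (real k * r ^ (k - 1))) * f r \<partial>lborel)"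
  unfolding power_density_def by (subst nn_integral_density) auto

lemma prob_space_power_density:
  assumes "0 < k"
  shows "prob_space (power_density k)"
proof
  have "emeasure (power_density k) (space (power_density k)) = emeasure (power_density k) {0..1}"
    using AE_power_density[of k] by (intro emeasure_eq_AE) auto
  then show "emeasure (power_density k) (space (power_density k)) = 1"
    using emeasure_power_density_Icc[of k 0] assms by simp
qed

text \<open>The half-line differs from \<open>{a..1}\<close> by a null set. Half-lines are the sets
  on which the law of the gauge is later compared with \<open>power_density\<close>.\<close>

lemma emeasure_power_density_greaterThan:
  assumes "0 < k" "0 \<le> a" "a \<le> 1"
  shows "emeasure (power_density k) {a<..} = ennreal (1 - a ^ k)"
proof -
  interpret prob_space "power_density k" by (rule prob_space_power_density) fact
  have "AE r in power_density k. r \<noteq> a"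
    using emeasure_power_density_singleton[of k a]
    by (intro AE_I[of _ _ "{a}"]) auto
  then have "emeasure (power_density k) {a<..} = emeasure (power_density k) {a..1}"
    using AE_power_density[of k] by (intro emeasure_eq_AE) (auto elim!: eventually_elim2)
  then show ?thesis
    using assms by (simp add: emeasure_power_density_Icc)
qed

lemma nn_integral_powr_power_density:
  assumes "0 < k" "0 < n"
  shows "(\<integral>\<^sup>+r. ennreal (r powr n) \<partial>power_density k) = ennreal (real k / (n + real k))"
proof -
  have "((\<lambda>r. real k * r powr (n + real k - 1)) has_integral (real k * (1 powr (n + real k - 1 + 1) / (n + real k - 1 + 1)))) {0..1}"
    using assms by (intro has_integral_mult_right has_integral_powr_from_0) auto
  then have I: "((\<lambda>r. real k * r powr (n + real k - 1)) has_integral (real k / (n + real k))) {0..1}"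
    by simp
  \<comment> \<open>At r = 0 both sides vanish because \<open>0 powr n\<close> is 0, even for k = 1,
    where \<open>r ^ (k - 1)\<close> is 1.\<close>
  have eq: "ennreal (indicator {0..1} r * (real k * r ^ (k - 1))) * ennreal (r powr n)
      = ennreal (real k * r powr (n + real k - 1)) * indicator {0..1} r" for r
  proof (cases "0 < r \<and> r \<le> 1")
    case True
    then have "r ^ (k - 1) * r powr n = r powr (n + real k - 1)"
      using assms by (simp add: powr_realpow[symmetric] powr_add[symmetric] of_nat_diff algebra_simps)
    then show ?thesis using True
      by (simp add: ennreal_mult'[symmetric] mult.assoc)
  next
    case False
    then show ?thesis using assms by (cases "r = 0") (auto split: split_indicator)
  qed
  show ?thesis
    by (subst nn_integral_power_density)
      (simp_all only: eq, use nn_integral_has_integral_lebesgue'[OF _ I] in simp_all)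
qed

text \<open>The substitution \<open>y = s r\<close> turns \<open>F s\<close> into \<open>\<integral>\<^sub>0\<^sup>s k y\<^sup>k\<^sup>-\<^sup>1 \<phi>(y) dy\<close>, for either sign of \<open>s\<close>.\<close>

lemma radial_average_has_vector_derivative:
  fixes \<phi> :: "real \<Rightarrow> complex"
  assumes cont: "continuous_on UNIV \<phi>" and k: "0 < k"
  defines "F \<equiv> \<lambda>s. complex_of_real s ^ k * (LBINT r=0..1. (real k * r ^ (k - 1)) *\<^sub>R \<phi> (s * r))"
  shows "(F has_vector_derivative (of_nat k * complex_of_real t ^ (k - 1) * \<phi> t)) (at t)"
proof -
  define p where "p = (\<lambda>y. (real k * y ^ (k - 1)) *\<^sub>R \<phi> y)"
  define P where "P = (\<lambda>u::real. LBINT y=0..u. p y)"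
  have contp: "continuous_on S p" for S
    unfolding p_def by (intro continuous_intros continuous_on_subset[OF cont]) auto
  have derP: "(P has_vector_derivative p u) (at u)" for u
  proof -
    \<comment> \<open>The interval has to contain both 0 and \<open>u\<close>; the margin 1 puts
      \<open>u\<close> in its interior, so the derivative within the interval is two-sided.\<close>
    define a where "a = \<bar>u\<bar> + 1"
    have "(P has_vector_derivative p u) (at u within {-a..a})"
      unfolding P_def zero_ereal_def using contp by (intro interval_integral_FTC2) (auto simp: a_def)
    moreover have "at u within {-a..a} = at u"
      by (rule at_within_Icc_at) (auto simp: a_def)
    ultimately show ?thesis by simp
  qed
  have scale: "(LBINT r=0..1. a *\<^sub>R f r) = a *\<^sub>R (LBINT r=0..1. f r)" for a :: real and f :: "real \<Rightarrow> complex"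
    by (simp add: interval_lebesgue_integral_def set_lebesgue_integral_def scaleR_left_commute[of _ a])
  have "F s = P s" for s
  proof -
    have "F s = s ^ k *\<^sub>R (LBINT r=0..1. (real k * r ^ (k - 1)) *\<^sub>R \<phi> (s * r))"
      by (simp add: F_def scaleR_conv_of_real)
    also have "\<dots> = (LBINT r=0..1. s ^ k *\<^sub>R ((real k * r ^ (k - 1)) *\<^sub>R \<phi> (s * r)))"
      by (rule scale[symmetric])
    \<comment> \<open>One factor of \<open>s ^ k\<close> is the derivative of \<open>s * r\<close>
      in r; the other k - 1 factors are absorbed into \<open>p (s * r)\<close>.\<close>
    also have "(\<lambda>r. s ^ k *\<^sub>R ((real k * r ^ (k - 1)) *\<^sub>R \<phi> (s * r))) = (\<lambda>r. s *\<^sub>R p (s * r))"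
    proof
      fix r
      have "s ^ k = s * s ^ (k - 1)" using k by (cases k) auto
      then show "s ^ k *\<^sub>R ((real k * r ^ (k - 1)) *\<^sub>R \<phi> (s * r)) = s *\<^sub>R p (s * r)"
        by (simp add: p_def power_mult_distrib mult_ac)
    qed
    \<comment> \<open>In r, \<open>P (s * r)\<close> is an antiderivative of the integrand, whatever
      the sign of \<open>s\<close> and also for \<open>s = 0\<close>.\<close>
    also have "(LBINT r=0..1. s *\<^sub>R p (s * r)) = P (s * 1) - P (s * 0)"
      unfolding zero_ereal_def one_ereal_def
    proof (rule interval_integral_FTC_finite)
      show "continuous_on {min 0 1..max 0 1} (\<lambda>r. s *\<^sub>R p (s * r))"
        by (intro continuous_intros continuous_on_compose2[OF contp[of UNIV]]) auto
      fix r :: real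
      have "((\<lambda>r. s * r) has_vector_derivative s) (at r)"
        by (auto intro!: derivative_eq_intros)
      from vector_diff_chain_at[OF this derP]
      show "((\<lambda>r. P (s * r)) has_vector_derivative s *\<^sub>R p (s * r)) (at r within {min 0 1..max 0 1})"
        by (auto simp: o_def intro: has_vector_derivative_at_within)
    qed
    also have "P (s * 0) = 0"
      by (simp add: P_def zero_ereal_def[symmetric] interval_integral_endpoints_same)
    finally show ?thesis by simp
  qed
  then have "F = P" by auto
  moreover have "of_nat k * complex_of_real t ^ (k - 1) * \<phi> t = p t"
    by (simp add: p_def scaleR_conv_of_real)
  ultimately show ?thesis using derP[of t] by simp
qed

section \<open>Moments and characteristic functions of power mixtures\<close>

context
  fixes M :: "'w measure" and U W :: "'w \<Rightarrow> real" and k :: nat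
  assumes M: "prob_space M" and k: "0 < k"
    and UW [measurable]: "U \<in> borel_measurable M" "W \<in> borel_measurable M"
    and mix: "\<And>f. f \<in> borel_measurable borel \<Longrightarrow>
      (\<integral>\<^sup>+w. f (W w) \<partial>M) = (\<integral>\<^sup>+r. \<integral>\<^sup>+w. f (r * U w) \<partial>M \<partial>power_density k)"
begin

text \<open>The power of \<open>r * U w\<close> factors, which separates the moment of
  \<open>power_density k\<close> from that of \<open>U\<close>. The computation runs in the extended
  nonnegative reals; an infinite moment becomes 0 on both sides of the conclusion.\<close>

lemma moment_power_mixture:
  assumes "\<And>w. 0 \<le> U w" and n: "0 < n"
  shows "(\<integral>w. W w powr n \<partial>M) = real k / (n + real k) * (\<integral>w. U w powr n \<partial>M)"
proof -
  have "(\<integral>\<^sup>+w. ennreal (W w powr n) \<partial>M) = (\<integral>\<^sup>+r. \<integral>\<^sup>+w. ennreal ((r * U w) powr n) \<partial>M \<partial>power_density k)"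
    by (rule mix) measurable
  also have "\<dots> = (\<integral>\<^sup>+r. ennreal (r powr n) * (\<integral>\<^sup>+w. ennreal (U w powr n) \<partial>M) \<partial>power_density k)"
  proof (rule nn_integral_cong_AE)
    show "AE r in power_density k. (\<integral>\<^sup>+w. ennreal ((r * U w) powr n) \<partial>M)
        = ennreal (r powr n) * (\<integral>\<^sup>+w. ennreal (U w powr n) \<partial>M)"
      using AE_power_density
      by eventually_elim (simp add: powr_mult assms ennreal_mult nn_integral_cmult)
  qed
  also have "\<dots> = ennreal (real k / (n + real k)) * (\<integral>\<^sup>+w. ennreal (U w powr n) \<partial>M)"
    using k n by (subst nn_integral_multc) (auto simp: nn_integral_powr_power_density)
  finally show ?thesis
    using n by (simp add: integral_eq_nn_integral enn2real_mult)
qed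

text \<open>The assumption \<open>mix\<close> concerns nonnegative functions. Applied to indicators
  it becomes an identity of laws, which serves the complex integrals in \<open>char\<close>.\<close>

lemma distr_power_mixture:
  "distr M borel W = distr (power_density k \<Otimes>\<^sub>M M) borel (\<lambda>p. fst p * U (snd p))"
proof (rule measure_eqI)
  interpret prob_space M by (rule M)
  fix A assume "A \<in> sets (distr M borel W)"
  then have [measurable]: "A \<in> sets borel" by simp
  have "emeasure (distr M borel W) A = (\<integral>\<^sup>+w. indicator A (W w) \<partial>M)"
    by (subst nn_integral_indicator[symmetric]) (auto simp: nn_integral_distr simp del: nn_integral_indicator)
  also have "\<dots> = (\<integral>\<^sup>+r. \<integral>\<^sup>+w. indicator A (r * U w) \<partial>M \<partial>power_density k)"
    by (rule mix) measurable
  also have "\<dots> = (\<integral>\<^sup>+p. indicator A (fst p * U (snd p)) \<partial>(power_density k \<Otimes>\<^sub>M M))"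
    by (subst nn_integral_fst[symmetric]) auto
  also have "\<dots> = emeasure (distr (power_density k \<Otimes>\<^sub>M M) borel (\<lambda>p. fst p * U (snd p))) A"
    by (subst nn_integral_indicator[symmetric]) (auto simp: nn_integral_distr simp del: nn_integral_indicator)
  finally show "emeasure (distr M borel W) A
    = emeasure (distr (power_density k \<Otimes>\<^sub>M M) borel (\<lambda>p. fst p * U (snd p))) A" .
qed simp

lemma char_power_mixture:
  "char (distr M borel W) s = (LBINT r=0..1. (real k * r ^ (k - 1)) *\<^sub>R char (distr M borel U) (s * r))"
proof -
  interpret prob_space M by (rule M)
  interpret pd: prob_space "power_density k" using k by (rule prob_space_power_density)
  interpret PM: pair_prob_space "power_density k" M ..
  interpret U: real_distribution "distr M borel U" by simp
  let ?\<phi> = "char (distr M borel U)"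
  have "char (distr M borel W) s = (\<integral>p. iexp (s * (fst p * U (snd p))) \<partial>(power_density k \<Otimes>\<^sub>M M))"
    unfolding char_def distr_power_mixture by (subst integral_distr) auto
  \<comment> \<open>Fubini applies because the integrand has norm 1 on a probability space.\<close>
  also have "\<dots> = (\<integral>r. \<integral>w. iexp (s * (r * U w)) \<partial>M \<partial>power_density k)"
    by (subst PM.integral_fst'[symmetric]) (auto intro!: PM.P.integrable_const_bound[where B=1] simp del: of_real_mult)
  also have "\<dots> = (\<integral>r. ?\<phi> (s * r) \<partial>power_density k)"
    unfolding char_def by (subst integral_distr) (auto simp: mult_ac)
  also have "\<dots> = (\<integral>r. (indicator {0..1} r * (real k * r ^ (k - 1))) *\<^sub>R ?\<phi> (s * r) \<partial>lborel)"
    unfolding power_density_def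
    by (subst integral_density) (auto intro!: AE_I2 split: split_indicator)
  also have "\<dots> = (LBINT r:{0..1}. (real k * r ^ (k - 1)) *\<^sub>R ?\<phi> (s * r))"
    by (simp add: set_lebesgue_integral_def)
  also have "\<dots> = (LBINT r=0..1. (real k * r ^ (k - 1)) *\<^sub>R ?\<phi> (s * r))"
    unfolding zero_ereal_def one_ereal_def by (subst interval_integral_Icc) auto
  finally show ?thesis .
qed

text \<open>By \<open>char_power_mixture\<close>, \<open>F\<close> is a radial average of the
  continuous characteristic function of \<open>U\<close>. Its derivative at \<open>t\<close> is k
  t^(k-1) times that function, and \<open>t \<noteq> 0\<close> permits the division.\<close>

lemma characteristic_function_power_mixture:
  assumes "t \<noteq> 0"
  shows "let F = (\<lambda>s::real. complex_of_real s ^ k * (\<integral>w. exp (\<i> * complex_of_real (s * W w)) \<partial>M))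
    in F differentiable (at t) \<and>
       (\<integral>w. exp (\<i> * complex_of_real (t * U w)) \<partial>M)
         = vector_derivative F (at t) / (of_nat k * complex_of_real t ^ (k - 1))"
proof -
  interpret prob_space M by (rule M)
  interpret U: real_distribution "distr M borel U" by simp
  let ?\<phi> = "char (distr M borel U)"
  define F where "F = (\<lambda>s::real. complex_of_real s ^ k * (\<integral>w. exp (\<i> * complex_of_real (s * W w)) \<partial>M))"
  have F: "F = (\<lambda>s. complex_of_real s ^ k * (LBINT r=0..1. (real k * r ^ (k - 1)) *\<^sub>R ?\<phi> (s * r)))"
    unfolding F_def char_power_mixture[symmetric] by (simp add: char_def integral_distr)
  have "continuous_on UNIV ?\<phi>"
    by (intro continuous_at_imp_continuous_on ballI U.isCont_char)
  then have der: "(F has_vector_derivative (of_nat k * complex_of_real t ^ (k - 1) * ?\<phi> t)) (at t)"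
    unfolding F using k by (rule radial_average_has_vector_derivative)
  moreover have "?\<phi> t = (\<integral>w. exp (\<i> * complex_of_real (t * U w)) \<partial>M)"
    unfolding char_def by (subst integral_distr) auto
  ultimately show ?thesis
    unfolding Let_def F_def[symmetric] using k assms
    by (auto simp: vector_derivative_at intro: differentiableI_vector)
qed

end

section \<open>Geometry of the gauge and of the radial projection\<close>

context
  fixes K :: "'a::euclidean_space set" and c :: 'a
  assumes K: "convex_body K" and c: "c \<in> interior K"
begin

abbreviation (input) "rho \<equiv> gauge_about K c"
abbreviation (input) "proj \<equiv> radial_projection K c"

lemmas [simp del] = emeasure_uniform_measure

text \<open>Here \<open>d\<close> is the parameter at which the ray leaves \<open>K\<close>. A point
  of \<open>K\<close> beyond it, shrunk towards the interior point \<open>c\<close>, would make the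
  frontier point at \<open>d\<close> interior.\<close>

lemma ray_frontier:
  assumes "z \<noteq> c"
  obtains d where "0 < d" "proj z = c + d *\<^sub>R (z - c)"
    "\<And>e. 0 \<le> e \<Longrightarrow> c + e *\<^sub>R (z - c) \<in> K \<longleftrightarrow> e \<le> d"
proof -
  have "convex K" "compact K" using K by (auto simp: convex_body_def)
  then have "bounded K" "closed K" by (auto intro: compact_imp_bounded compact_imp_closed)
  obtain d where d: "0 < d" "c + d *\<^sub>R (z - c) \<in> frontier K"
    "\<And>e. 0 \<le> e \<Longrightarrow> e < d \<Longrightarrow> c + e *\<^sub>R (z - c) \<in> interior K"
    using ray_to_frontier[OF \<open>bounded K\<close> c, of "z - c"] assms by auto
  have out: "c + e *\<^sub>R (z - c) \<notin> K" if "d < e" for e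
  proof
    assume "c + e *\<^sub>R (z - c) \<in> K"
    \<comment> \<open>The ratio \<open>1 - d / e\<close> is the one that moves the point with
      parameter \<open>e\<close> back to parameter \<open>d\<close>.\<close>
    then have "(c + e *\<^sub>R (z - c)) - (1 - d / e) *\<^sub>R ((c + e *\<^sub>R (z - c)) - c) \<in> interior K"
      using \<open>convex K\<close> c d(1) that by (intro mem_interior_convex_shrink) auto
    moreover have "(c + e *\<^sub>R (z - c)) - (1 - d / e) *\<^sub>R ((c + e *\<^sub>R (z - c)) - c) = c + d *\<^sub>R (z - c)"
      using d(1) that by (simp add: algebra_simps)
    ultimately have "c + d *\<^sub>R (z - c) \<in> interior K" by metis
    then show False using d(2) by (simp add: frontier_def)
  qed
  have frontier_sub: "frontier K \<subseteq> K"
    using \<open>closed K\<close> frontier_subset_closed by blast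
  have mem: "c + e *\<^sub>R (z - c) \<in> K \<longleftrightarrow> e \<le> d" if "0 \<le> e" for e
    using out[of e] d(2) d(3)[of e] that frontier_sub interior_subset[of K]
    by (cases e d rule: linorder_cases) auto
  have "proj z = c + d *\<^sub>R (z - c)"
    unfolding radial_projection_def
  proof (rule the_equality)
    show "c + d *\<^sub>R (z - c) \<in> frontier K \<and> (\<exists>r>0. c + d *\<^sub>R (z - c) = c + r *\<^sub>R (z - c))"
      using d by auto
  next
    fix y assume "y \<in> frontier K \<and> (\<exists>r>0. y = c + r *\<^sub>R (z - c))"
    then obtain r where r: "r > 0" "y = c + r *\<^sub>R (z - c)" "y \<in> frontier K" by blast
    then have "r \<le> d" using mem[of r] frontier_sub by auto
    moreover have "\<not> r < d" using d(3)[of r] r by (auto simp: frontier_def)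
    ultimately show "y = c + d *\<^sub>R (z - c)" using r by simp
  qed
  then show ?thesis using d(1) mem that by blast
qed

text \<open>The gauge is the reciprocal of the exit parameter of the ray, so its sublevel sets are
  homothetic copies of \<open>K\<close>; this identifies \<open>rho\<close> as the Minkowski
  functional about \<open>c\<close>.\<close>

lemma gauge_about_le_iff:
  assumes "0 < t"
  shows "rho z \<le> t \<longleftrightarrow> c + (1 / t) *\<^sub>R (z - c) \<in> K"
proof (cases "z = c")
  case True
  then show ?thesis using assms c interior_subset[of K] by auto
next
  case False
  then obtain d where d: "0 < d" "proj z = c + d *\<^sub>R (z - c)"
    "\<And>e. 0 \<le> e \<Longrightarrow> c + e *\<^sub>R (z - c) \<in> K \<longleftrightarrow> e \<le> d"
    by (rule ray_frontier) blast
  then have "rho z = 1 / d" using False by (simp add: gauge_about_def)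
  then have "rho z \<le> t \<longleftrightarrow> 1 / t \<le> d" using d(1) assms by (simp only:) (simp add: field_simps)
  then show ?thesis using d(3)[of "1 / t"] assms by simp
qed

lemma mem_iff_gauge_about_le: "z \<in> K \<longleftrightarrow> rho z \<le> 1"
  using gauge_about_le_iff[of 1 z] by simp

lemma radial_projection_eq:
  assumes "z \<noteq> c"
  shows "proj z = c + (1 / rho z) *\<^sub>R (z - c)"
proof -
  obtain d where d: "0 < d" "proj z = c + d *\<^sub>R (z - c)"
    using assms by (rule ray_frontier)
  then have "rho z = 1 / d" using assms by (simp add: gauge_about_def)
  with d show ?thesis by simp
qed

lemma gauge_about_pos:
  assumes "z \<noteq> c"
  shows "0 < rho z"
  using assms by (rule ray_frontier) (use assms in \<open>simp add: gauge_about_def\<close>)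

text \<open>At \<open>z = c\<close> the factor \<open>rho c = 0\<close> annihilates the unspecified
  value of the projection.\<close>

lemma polar_decomposition: "c + rho z *\<^sub>R (proj z - c) = z"
  using gauge_about_pos[of z] by (cases "z = c") (auto simp: radial_projection_eq)

text \<open>All sublevel sets are closed: empty for t < 0, the centre alone for t = 0, and the
  preimage of \<open>K\<close> under a homothety for t > 0.\<close>

lemma borel_measurable_gauge_about [measurable]: "rho \<in> borel_measurable borel"
proof (rule borel_measurableI_le)
  fix t :: real
  consider "t < 0" | "t = 0" | "0 < t" by linarith
  then show "{z \<in> space borel. rho z \<le> t} \<in> sets borel"
  proof cases
    case 1
    then have "{z \<in> space borel. rho z \<le> t} = {}"
      using gauge_about_nonneg[of K c] by (auto simp: not_le intro: less_le_trans)
    then show ?thesis by simp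
  next
    case 2
    then have "{z \<in> space borel. rho z \<le> t} = {c}"
      using gauge_about_pos by (auto simp: not_le[symmetric])
    then show ?thesis by simp
  next
    case 3
    have "closed K" using K by (auto simp: convex_body_def intro: compact_imp_closed)
    then have "closed ((\<lambda>z. c + (1 / t) *\<^sub>R (z - c)) -` K)"
      by (intro continuous_closed_vimage) auto
    then show ?thesis using gauge_about_le_iff[OF 3] by (simp add: vimage_def)
  qed
qed

text \<open>Away from \<open>c\<close> the projection is an explicit measurable expression in
  \<open>rho\<close>; the Borel set \<open>{c}\<close> carries a single further value.\<close>

lemma borel_measurable_radial_projection [measurable]: "proj \<in> borel_measurable borel"
proof -
  have "proj = (\<lambda>z. if z = c then proj c else c + (1 / rho z) *\<^sub>R (z - c))"
    by (auto simp: radial_projection_eq)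
  also have "\<dots> \<in> borel_measurable borel" by measurable
  finally show ?thesis .
qed

section \<open>The uniform law in polar coordinates\<close>

abbreviation (input) "mu \<equiv> uniform_measure lborel K"
abbreviation (input) "nu \<equiv> projective_distribution K c"

lemma sets_convex_body [measurable]: "K \<in> sets borel"
  using K by (auto simp: convex_body_def intro: compact_imp_closed borel_closed)

text \<open>A nonempty open interior forces positive volume, and boundedness forces finite volume,
  so the normalisation is legitimate.\<close>

lemma prob_space_uniform_convex_body: "prob_space mu"
proof (rule prob_space_uniform_measure)
  have "\<not> negligible (interior K)"
    using K by (intro open_not_negligible) (auto simp: convex_body_def)
  then have "interior K \<notin> null_sets lborel"
    using null_sets_completionI negligible_iff_null_sets by blast
  then have "0 < emeasure lborel (interior K)"
    by (auto simp: null_sets_def zero_less_iff_neq_zero)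
  also have "\<dots> \<le> emeasure lborel K"
    using sets_convex_body by (intro emeasure_mono interior_subset) auto
  finally show "emeasure lborel K \<noteq> 0" by simp
  show "emeasure lborel K \<noteq> \<infinity>"
    using K emeasure_bounded_finite[of K] by (auto simp: convex_body_def dest: compact_imp_bounded)
qed

lemma prob_space_projective_distribution: "prob_space nu"
  unfolding projective_distribution_def
  by (intro prob_space.prob_space_distr prob_space_uniform_convex_body) simp

lemma sets_projective_distribution [measurable_cong, simp]: "sets nu = sets borel"
  by (simp add: projective_distribution_def)

text \<open>The homothety with ratio \<open>r\<close> carries \<open>K\<close> onto the sublevel
  set, with Jacobian r^d; the normalising volume is the same on both sides.\<close>

lemma nn_integral_uniform_scale:
  assumes [measurable]: "f \<in> borel_measurable borel" and r: "0 < r" "r \<le> 1"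
  shows "(\<integral>\<^sup>+x. indicator {x. rho x \<le> r} x * f x \<partial>mu)
       = ennreal (r ^ DIM('a)) * (\<integral>\<^sup>+x. f (c + r *\<^sub>R (x - c)) \<partial>mu)"
proof -
  have "(\<integral>\<^sup>+x. indicator {x. rho x \<le> r} x * f x \<partial>mu)
      = (\<integral>\<^sup>+x. indicator {x. rho x \<le> r} x * f x * indicator K x \<partial>lborel) / emeasure lborel K"
    by (subst nn_integral_uniform_measure) auto
  \<comment> \<open>Because \<open>r \<le> 1\<close>, the sublevel set already lies in
    \<open>K\<close>.\<close>
  also have "(\<integral>\<^sup>+x. indicator {x. rho x \<le> r} x * f x * indicator K x \<partial>lborel)
      = (\<integral>\<^sup>+x. indicator {x. rho x \<le> r} x * f x \<partial>lborel)"
    using r by (intro nn_integral_cong) (auto simp: mem_iff_gauge_about_le split: split_indicator)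
  also have "\<dots> = ennreal (r ^ DIM('a)) * (\<integral>\<^sup>+x. indicator {x. rho x \<le> r} (c + r *\<^sub>R (x - c)) * f (c + r *\<^sub>R (x - c)) \<partial>lborel)"
    using r by (intro nn_integral_lborel_affine) auto
  also have "(\<integral>\<^sup>+x. indicator {x. rho x \<le> r} (c + r *\<^sub>R (x - c)) * f (c + r *\<^sub>R (x - c)) \<partial>lborel)
      = (\<integral>\<^sup>+x. f (c + r *\<^sub>R (x - c)) * indicator K x \<partial>lborel)"
    using r by (intro nn_integral_cong) (auto simp: gauge_about_scale mem_iff_gauge_about_le split: split_indicator)
  finally show ?thesis
    by (subst nn_integral_uniform_measure) (auto simp: ennreal_times_divide)
qed

text \<open>The projection is constant on open rays from \<open>c\<close>, so shrinking by
  \<open>r\<close> preserves the condition on \<open>proj z\<close> and costs only the volume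
  factor. This product form is the source of the independence of radius and projected point.\<close>

lemma emeasure_uniform_gauge_le:
  assumes [measurable]: "B \<in> sets borel" and r: "0 \<le> r" "r \<le> 1"
  shows "emeasure mu {z. rho z \<le> r \<and> proj z \<in> B} = ennreal (r ^ DIM('a)) * emeasure mu {z. proj z \<in> B}"
proof (cases "r = 0")
  \<comment> \<open>The ratio 0 is outside the scaling formula. The event is then contained in the
    null set \<open>{c}\<close>, and the right side vanishes because the dimension is
    positive.\<close>
  case True
  have "rho z = 0 \<longleftrightarrow> z = c" for z using gauge_about_pos[of z] by force
  then have "{z. rho z \<le> r \<and> proj z \<in> B} \<subseteq> {c}"
    using True gauge_about_nonneg[of K c] by (auto simp: antisym_conv)
  then have "emeasure mu {z. rho z \<le> r \<and> proj z \<in> B} \<le> emeasure mu {c}"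
    by (intro emeasure_mono) auto
  also have "\<dots> = 0"
  proof -
    have "emeasure lborel (K \<inter> {c}) \<le> emeasure lborel {c}" by (intro emeasure_mono) auto
    then show ?thesis by (simp add: emeasure_uniform_measure)
  qed
  finally show ?thesis
    using True by (simp add: zero_power)
next
  case False
  have "emeasure mu {z. rho z \<le> r \<and> proj z \<in> B}
      = (\<integral>\<^sup>+z. indicator {z. rho z \<le> r} z * indicator {z. proj z \<in> B} z \<partial>mu)"
    by (subst nn_integral_indicator[symmetric])
      (auto intro!: nn_integral_cong split: split_indicator simp del: nn_integral_indicator)
  also have "\<dots> = ennreal (r ^ DIM('a)) * (\<integral>\<^sup>+z. indicator {z. proj z \<in> B} (c + r *\<^sub>R (z - c)) \<partial>mu)"
    using False r by (intro nn_integral_uniform_scale) auto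
  also have "(\<integral>\<^sup>+z. indicator {z. proj z \<in> B} (c + r *\<^sub>R (z - c)) \<partial>mu) = (\<integral>\<^sup>+z. indicator {z. proj z \<in> B} z \<partial>mu)"
    using False r by (intro nn_integral_cong) (simp add: radial_projection_scale indicator_def)
  finally show ?thesis by simp
qed

lemma AE_uniform_gauge_about: "AE z in mu. 0 < rho z \<and> rho z \<le> 1"
proof (rule AE_uniform_measureI)
  show "AE z in lborel. z \<in> K \<longrightarrow> 0 < rho z \<and> rho z \<le> 1"
    by (rule eventually_mono[OF AE_lborel_singleton[of c]]) (simp add: mem_iff_gauge_about_le gauge_about_pos)
qed simp

text \<open>It suffices to compare rectangles. With the set of projected points fixed, both sides
  are finite measures in the radius, and these are determined by their values on half-lines.\<close>

lemma polar_law: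
  "power_density DIM('a) \<Otimes>\<^sub>M nu = distr mu (borel \<Otimes>\<^sub>M borel) (\<lambda>z. (rho z, proj z))"
proof (rule pair_measure_eqI)
  interpret mu: prob_space mu by (rule prob_space_uniform_convex_body)
  interpret nu: prob_space nu by (rule prob_space_projective_distribution)
  interpret pd: prob_space "power_density DIM('a)" by (rule prob_space_power_density) simp
  show "sigma_finite_measure (power_density DIM('a))" "sigma_finite_measure nu"
    by unfold_locales
  show "sets (power_density DIM('a) \<Otimes>\<^sub>M nu) = sets (distr mu (borel \<Otimes>\<^sub>M borel) (\<lambda>z. (rho z, proj z)))"
    by (simp cong: sets_pair_measure_cong)
  fix A B assume "A \<in> sets (power_density DIM('a))" "B \<in> sets nu"
  then have [measurable]: "A \<in> sets borel" "B \<in> sets borel" by simp_all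
  define P where "P = {z. proj z \<in> B}"
  have [measurable]: "P \<in> sets borel" unfolding P_def by measurable
  have nuB: "emeasure nu B = emeasure mu P"
    by (simp add: projective_distribution_def emeasure_distr P_def vimage_def)
  \<comment> \<open>The law of the radius is restricted to \<open>P\<close> without normalising, so
    \<open>P\<close> may have measure zero.\<close>
  define N1 where "N1 = distr (density mu (indicator P)) borel rho"
  define N2 where "N2 = scale_measure (emeasure mu P) (power_density DIM('a))"
  have N1: "emeasure N1 C = emeasure mu {z. rho z \<in> C \<and> z \<in> P}" if [measurable]: "C \<in> sets borel" for C
  proof -
    have "emeasure N1 C = (\<integral>\<^sup>+z. indicator P z * indicator {z. rho z \<in> C} z \<partial>mu)"
      unfolding N1_def by (subst emeasure_distr) (simp_all add: emeasure_density vimage_def)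
    also have "\<dots> = (\<integral>\<^sup>+z. indicator {z. rho z \<in> C \<and> z \<in> P} z \<partial>mu)"
      by (intro nn_integral_cong) (auto split: split_indicator)
    finally show ?thesis by simp
  qed
  have "N1 = N2"
  proof (rule measure_eqI_lessThan)
    show "sets N1 = sets borel" "sets N2 = sets borel" by (simp_all add: N1_def N2_def)
    fix x :: real
    show "emeasure N1 {x<..} < \<infinity>"
      by (subst N1) (auto simp: less_top[symmetric] mu.emeasure_finite)
    \<comment> \<open>Both measures live on \<open>(0, 1]\<close>, so the threshold may be clamped to \<open>[0, 1]\<close>.\<close>
    define y where "y = max 0 (min 1 x)"
    have y: "0 \<le> y" "y \<le> 1" by (auto simp: y_def)
    have xy: "x < r \<longleftrightarrow> y < r" if "0 < r \<and> r \<le> 1" for r using that by (auto simp: y_def)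
    have "emeasure N1 {x<..} = emeasure mu {z. x < rho z \<and> z \<in> P}"
      by (subst N1) auto
    also have "\<dots> = emeasure mu {z. y < rho z \<and> z \<in> P}"
    proof (intro emeasure_eq_AE)
      show "AE z in mu. z \<in> {z. x < rho z \<and> z \<in> P} \<longleftrightarrow> z \<in> {z. y < rho z \<and> z \<in> P}"
        using AE_uniform_gauge_about by eventually_elim (use xy in auto)
    qed simp_all
    \<comment> \<open>The complement within \<open>P\<close> turns the formula for sublevel sets
      into one for half-lines.\<close>
    also have "\<dots> = emeasure mu (P - {z. rho z \<le> y \<and> z \<in> P})"
      by (intro arg_cong[where f="emeasure mu"]) auto
    also have "\<dots> = emeasure mu P - emeasure mu {z. rho z \<le> y \<and> z \<in> P}"
      by (intro emeasure_Diff) (auto simp: mu.emeasure_finite)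
    also have "emeasure mu {z. rho z \<le> y \<and> z \<in> P} = ennreal (y ^ DIM('a)) * emeasure mu P"
      unfolding P_def using y by (simp add: emeasure_uniform_gauge_le)
    also have "emeasure mu P - ennreal (y ^ DIM('a)) * emeasure mu P = emeasure mu P * ennreal (1 - y ^ DIM('a))"
      using y by (simp add: mu.emeasure_eq_measure ennreal_mult'[symmetric] ennreal_minus algebra_simps)
    also have "\<dots> = emeasure mu P * emeasure (power_density DIM('a)) {y<..}"
      using y by (simp add: emeasure_power_density_greaterThan)
    also have "emeasure (power_density DIM('a)) {y<..} = emeasure (power_density DIM('a)) {x<..}"
    proof (intro emeasure_eq_AE)
      show "AE r in power_density DIM('a). r \<in> {y<..} \<longleftrightarrow> r \<in> {x<..}"
        using AE_power_density by eventually_elim (use xy in auto)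
    qed simp_all
    finally show "emeasure N1 {x<..} = emeasure N2 {x<..}"
      by (simp add: N2_def)
  qed
  then have "emeasure mu {z. rho z \<in> A \<and> z \<in> P} = emeasure mu P * emeasure (power_density DIM('a)) A"
    using N1[of A] by (simp add: N2_def)
  then show "emeasure (power_density DIM('a)) A * emeasure nu B
      = emeasure (distr mu (borel \<Otimes>\<^sub>M borel) (\<lambda>z. (rho z, proj z))) (A \<times> B)"
    by (subst emeasure_distr) (auto simp: nuB P_def vimage_def mult.commute)
qed

lemma nn_integral_polar:
  assumes [measurable]: "g \<in> borel_measurable (borel \<Otimes>\<^sub>M borel)"
  shows "(\<integral>\<^sup>+z. g (rho z, proj z) \<partial>mu) = (\<integral>\<^sup>+r. \<integral>\<^sup>+y. g (r, y) \<partial>nu \<partial>power_density DIM('a))"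
proof -
  interpret nu: prob_space nu by (rule prob_space_projective_distribution)
  have "(\<integral>\<^sup>+z. g (rho z, proj z) \<partial>mu) = (\<integral>\<^sup>+p. g p \<partial>(power_density DIM('a) \<Otimes>\<^sub>M nu))"
    unfolding polar_law by (subst nn_integral_distr) auto
  also have "\<dots> = (\<integral>\<^sup>+r. \<integral>\<^sup>+y. g (r, y) \<partial>nu \<partial>power_density DIM('a))"
    by (subst nu.nn_integral_fst[symmetric]) (auto cong: measurable_cong_sets)
  finally show ?thesis .
qed

text \<open>The law of the radius has no atoms, so ties between the gauges of two independent points
  are negligible.\<close>

lemma AE_uniform_gauge_about_neq: "AE x in mu. rho x \<noteq> r"
proof -
  interpret nu: prob_space nu by (rule prob_space_projective_distribution)
  have "emeasure mu {z. rho z = r} = (\<integral>\<^sup>+z. indicator {r} (fst (rho z, proj z)) \<partial>mu)"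
    by (subst nn_integral_indicator[symmetric])
      (auto intro!: nn_integral_cong split: split_indicator simp del: nn_integral_indicator)
  also have "\<dots> = (\<integral>\<^sup>+s. \<integral>\<^sup>+y. indicator {r} (fst (s, y)) \<partial>nu \<partial>power_density DIM('a))"
    by (rule nn_integral_polar) measurable
  also have "\<dots> = 0"
    by (simp add: nu.emeasure_space_1 emeasure_power_density_singleton)
  finally show ?thesis
    by (intro AE_I[of _ _ "{z. rho z = r}"]) auto
qed

section \<open>Distances as power mixtures\<close>

lemma nn_integral_dist_center:
  assumes [measurable]: "f \<in> borel_measurable borel"
  shows "(\<integral>\<^sup>+x. f (dist c x) \<partial>mu) = (\<integral>\<^sup>+r. \<integral>\<^sup>+y. f (r * dist c y) \<partial>nu \<partial>power_density DIM('a))"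
proof -
  have "(\<integral>\<^sup>+x. f (dist c x) \<partial>mu)
      = (\<integral>\<^sup>+x. (\<lambda>(r, y). f (dist c (c + r *\<^sub>R (y - c)))) (rho x, proj x) \<partial>mu)"
    by (simp add: polar_decomposition)
  also have "\<dots> = (\<integral>\<^sup>+r. \<integral>\<^sup>+y. f (dist c (c + r *\<^sub>R (y - c))) \<partial>nu \<partial>power_density DIM('a))"
    by (subst nn_integral_polar) auto
  also have "\<dots> = (\<integral>\<^sup>+r. \<integral>\<^sup>+y. f (r * dist c y) \<partial>nu \<partial>power_density DIM('a))"
  proof (rule nn_integral_cong_AE)
    show "AE r in power_density DIM('a).
      (\<integral>\<^sup>+y. f (dist c (c + r *\<^sub>R (y - c))) \<partial>nu) = (\<integral>\<^sup>+y. f (r * dist c y) \<partial>nu)"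
      using AE_power_density by eventually_elim (simp add: dist_norm norm_minus_commute)
  qed
  finally show ?thesis .
qed

lemma nn_integral_dist_two_points:
  assumes [measurable]: "f \<in> borel_measurable borel"
  shows "(\<integral>\<^sup>+x'. \<integral>\<^sup>+x. f (dist x x') \<partial>mu \<partial>mu)
       = (\<integral>\<^sup>+r. \<integral>\<^sup>+y. \<integral>\<^sup>+x. f (r * dist x y) \<partial>mu \<partial>nu \<partial>power_density (2 * DIM('a)))"
proof -
  interpret mu: prob_space mu by (rule prob_space_uniform_convex_body)
  interpret nu: prob_space nu by (rule prob_space_projective_distribution)
  interpret mm: pair_sigma_finite mu mu ..
  \<comment> \<open>The integral is split by which point has the larger gauge; ties are counted in
    \<open>?le\<close> only.\<close>
  let ?le = "\<lambda>x x'. indicator {x. rho x \<le> rho x'} x * f (dist x x')"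
  let ?lt = "\<lambda>x x'. indicator {x. rho x < rho x'} x * f (dist x x')"
  have "(\<integral>\<^sup>+x'. \<integral>\<^sup>+x. f (dist x x') \<partial>mu \<partial>mu) = (\<integral>\<^sup>+x'. \<integral>\<^sup>+x. ?le x x' + ?lt x' x \<partial>mu \<partial>mu)"
    by (intro nn_integral_cong) (auto simp: dist_commute split: split_indicator)
  also have "\<dots> = (\<integral>\<^sup>+x'. \<integral>\<^sup>+x. ?le x x' \<partial>mu \<partial>mu) + (\<integral>\<^sup>+x'. \<integral>\<^sup>+x. ?lt x' x \<partial>mu \<partial>mu)"
    by (simp add: nn_integral_add)
  \<comment> \<open>Exchanging the order of integration makes the second part a copy of the first,
    up to the null set of ties.\<close>
  also have "(\<integral>\<^sup>+x'. \<integral>\<^sup>+x. ?lt x' x \<partial>mu \<partial>mu) = (\<integral>\<^sup>+x. \<integral>\<^sup>+x'. ?lt x' x \<partial>mu \<partial>mu)"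
    by (rule mm.Fubini') measurable
  also have "\<dots> = (\<integral>\<^sup>+x. \<integral>\<^sup>+x'. ?le x' x \<partial>mu \<partial>mu)"
  proof (rule nn_integral_cong, rule nn_integral_cong_AE)
    fix x
    show "AE x' in mu. ?lt x' x = ?le x' x"
      using AE_uniform_gauge_about_neq[of "rho x"] by eventually_elim (auto split: split_indicator)
  qed
  also have "(\<integral>\<^sup>+x'. \<integral>\<^sup>+x. ?le x x' \<partial>mu \<partial>mu) + \<dots> = 2 * (\<integral>\<^sup>+x'. \<integral>\<^sup>+x. ?le x x' \<partial>mu \<partial>mu)"
    by (simp add: mult_2)
  \<comment> \<open>Only the point of larger gauge is put in polar coordinates; the other one ranges
    over the sublevel set at that radius.\<close>
  also have "(\<integral>\<^sup>+x'. \<integral>\<^sup>+x. ?le x x' \<partial>mu \<partial>mu)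
      = (\<integral>\<^sup>+x'. (\<lambda>(r, y). \<integral>\<^sup>+x. indicator {x. rho x \<le> r} x * f (dist x (c + r *\<^sub>R (y - c))) \<partial>mu) (rho x', proj x') \<partial>mu)"
    by (simp add: polar_decomposition)
  also have "\<dots> = (\<integral>\<^sup>+r. \<integral>\<^sup>+y. \<integral>\<^sup>+x. indicator {x. rho x \<le> r} x * f (dist x (c + r *\<^sub>R (y - c))) \<partial>mu \<partial>nu \<partial>power_density DIM('a))"
    by (subst nn_integral_polar) auto
  also have "\<dots> = (\<integral>\<^sup>+r. ennreal (r ^ DIM('a)) * (\<integral>\<^sup>+y. \<integral>\<^sup>+x. f (r * dist x y) \<partial>mu \<partial>nu) \<partial>power_density DIM('a))"
  proof (rule nn_integral_cong_AE)
    show "AE r in power_density DIM('a).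
      (\<integral>\<^sup>+y. \<integral>\<^sup>+x. indicator {x. rho x \<le> r} x * f (dist x (c + r *\<^sub>R (y - c))) \<partial>mu \<partial>nu)
      = ennreal (r ^ DIM('a)) * (\<integral>\<^sup>+y. \<integral>\<^sup>+x. f (r * dist x y) \<partial>mu \<partial>nu)"
      using AE_power_density
    proof eventually_elim
      case (elim r)
      \<comment> \<open>After \<open>x\<close> is rescaled, both points are images under one
        homothety, so \<open>r\<close> factors out of their distance.\<close>
      have "dist (c + r *\<^sub>R (x - c)) (c + r *\<^sub>R (y - c)) = r * dist x y" for x y
        using elim by (simp add: dist_norm scaleR_diff_right[symmetric])
      then have "(\<integral>\<^sup>+x. indicator {x. rho x \<le> r} x * f (dist x (c + r *\<^sub>R (y - c))) \<partial>mu)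
          = ennreal (r ^ DIM('a)) * (\<integral>\<^sup>+x. f (r * dist x y) \<partial>mu)" for y
        using elim by (subst nn_integral_uniform_scale) simp_all
      then show ?case
        by (simp add: nn_integral_cmult)
    qed
  qed
  also have "2 * \<dots> = (\<integral>\<^sup>+r. 2 * (ennreal (r ^ DIM('a)) * (\<integral>\<^sup>+y. \<integral>\<^sup>+x. f (r * dist x y) \<partial>mu \<partial>nu)) \<partial>power_density DIM('a))"
    by (subst nn_integral_cmult) auto
  also have "\<dots> = (\<integral>\<^sup>+r. \<integral>\<^sup>+y. \<integral>\<^sup>+x. f (r * dist x y) \<partial>mu \<partial>nu \<partial>power_density (2 * DIM('a)))"
  proof -
    \<comment> \<open>With d the dimension, 2 r^d times d r^(d-1) equals 2d r^(2d-1), the density of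
      the larger exponent.\<close>
    have "ennreal (indicator {0..1} r * (real DIM('a) * r ^ (DIM('a) - 1))) * (2 * (ennreal (r ^ DIM('a)) * h))
        = ennreal (indicator {0..1} r * (real (2 * DIM('a)) * r ^ (2 * DIM('a) - 1))) * h" for r h
    proof (cases "0 \<le> r \<and> r \<le> 1")
      case True
      have "DIM('a) - 1 + DIM('a) = 2 * DIM('a) - 1" using DIM_positive[where 'a='a] by linarith
      then have "r ^ (2 * DIM('a) - 1) = r ^ (DIM('a) - 1) * r ^ DIM('a)" by (simp add: power_add[symmetric])
      then show ?thesis using True
        by (simp add: ennreal_mult'[symmetric] mult.assoc[symmetric] ennreal_numeral[symmetric] del: ennreal_numeral)
          (simp add: mult_ac)
    qed auto
    then show ?thesis
      by (subst (1 2) nn_integral_power_density) auto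
  qed
  finally show ?thesis .
qed

end

section \<open>Passage to random variables\<close>

text \<open>Independence makes the joint law a product, and Tonelli gives the iterated integral. The
  second variable is outermost, to match \<open>nn_integral_dist_two_points\<close>.\<close>

lemma nn_integral_indep_var:
  assumes "prob_space M" and XY: "prob_space.indep_var M borel X borel Y"
    and g [measurable]: "case_prod g \<in> borel_measurable (borel \<Otimes>\<^sub>M borel)"
  shows "(\<integral>\<^sup>+w. g (X w) (Y w) \<partial>M) = (\<integral>\<^sup>+y. \<integral>\<^sup>+x. g x y \<partial>distr M borel X \<partial>distr M borel Y)"
proof -
  interpret prob_space M by fact
  have [measurable]: "X \<in> borel_measurable M" "Y \<in> borel_measurable M"
    and eq: "distr M borel X \<Otimes>\<^sub>M distr M borel Y = distr M (borel \<Otimes>\<^sub>M borel) (\<lambda>w. (X w, Y w))"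
    using XY by (auto simp: indep_var_distribution_eq)
  interpret X: prob_space "distr M borel X" by (rule prob_space_distr) simp
  interpret Y: prob_space "distr M borel Y" by (rule prob_space_distr) simp
  interpret pair_sigma_finite "distr M borel X" "distr M borel Y" ..
  have "(\<integral>\<^sup>+w. g (X w) (Y w) \<partial>M) = (\<integral>\<^sup>+p. case_prod g p \<partial>distr M (borel \<Otimes>\<^sub>M borel) (\<lambda>w. (X w, Y w)))"
    by (subst nn_integral_distr) auto
  also have "\<dots> = (\<integral>\<^sup>+y. \<integral>\<^sup>+x. case_prod g (x, y) \<partial>distr M borel X \<partial>distr M borel Y)"
    unfolding eq[symmetric] by (rule nn_integral_snd[symmetric]) (simp cong: measurable_cong_sets)
  finally show ?thesis by simp
qed

theorem theorem4:
  fixes K :: "'a::euclidean_space set" and c :: 'a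
    and M :: "'w measure" and X X' Y :: "'w \<Rightarrow> 'a"
  assumes "convex_body K" and "c \<in> interior K"
    and "prob_space M"
    and "X \<in> borel_measurable M" and "X' \<in> borel_measurable M" and "Y \<in> borel_measurable M"
    and "distr M borel X = uniform_measure lborel K"
    and "distr M borel X' = uniform_measure lborel K"
    and "prob_space.indep_var M borel X borel X'"
    and "distr M borel Y = projective_distribution K c"
    and "prob_space.indep_var M borel X borel Y"
  shows
    "(\<forall>n::real. n \<ge> 1 \<longrightarrow>
        (\<integral>w. dist (X w) (X' w) powr n \<partial>M)
          = 2 * real DIM('a) / (n + 2 * real DIM('a)) * (\<integral>w. dist (X w) (Y w) powr n \<partial>M))
   \<and> (\<forall>t::real. t \<noteq> 0 \<longrightarrow>
        (let F = (\<lambda>s::real. complex_of_real s ^ (2 * DIM('a))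
                    * (\<integral>w. exp (\<i> * complex_of_real (s * dist (X w) (X' w))) \<partial>M))
         in F differentiable (at t)
          \<and> (\<integral>w. exp (\<i> * complex_of_real (t * dist (X w) (Y w))) \<partial>M)
              = vector_derivative F (at t)
                / (2 * of_nat DIM('a) * complex_of_real t ^ (2 * DIM('a) - 1))))
   \<and> (\<forall>n::real. n \<ge> 1 \<longrightarrow>
        (\<integral>w. dist c (X w) powr n \<partial>M)
          = real DIM('a) / (n + real DIM('a)) * (\<integral>w. dist c (Y w) powr n \<partial>M))
   \<and> (\<forall>t::real. t \<noteq> 0 \<longrightarrow>
        (let G = (\<lambda>s::real. complex_of_real s ^ DIM('a)
                    * (\<integral>w. exp (\<i> * complex_of_real (s * dist c (X w))) \<partial>M))
         in G differentiable (at t)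
          \<and> (\<integral>w. exp (\<i> * complex_of_real (t * dist c (Y w))) \<partial>M)
              = vector_derivative G (at t)
                / (of_nat DIM('a) * complex_of_real t ^ (DIM('a) - 1))))"
proof -
  note K = assms(1,2) and X = assms(7) and X' = assms(8) and Y = assms(10)
  note [measurable] = assms(4-6)
  have pairs: "(\<integral>\<^sup>+w. f (dist (X w) (X' w)) \<partial>M)
      = (\<integral>\<^sup>+r. \<integral>\<^sup>+w. f (r * dist (X w) (Y w)) \<partial>M \<partial>power_density (2 * DIM('a)))"
    if [measurable]: "f \<in> borel_measurable borel" for f
    using nn_integral_dist_two_points[OF K that]
    by (subst (1 2) nn_integral_indep_var[OF assms(3)]) (simp_all add: assms(9,11) X X' Y)
  have centre: "(\<integral>\<^sup>+w. f (dist c (X w)) \<partial>M)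
      = (\<integral>\<^sup>+r. \<integral>\<^sup>+w. f (r * dist c (Y w)) \<partial>M \<partial>power_density DIM('a))"
    if [measurable]: "f \<in> borel_measurable borel" for f
  proof -
    have "(\<integral>\<^sup>+w. f (dist c (X w)) \<partial>M) = (\<integral>\<^sup>+x. f (dist c x) \<partial>uniform_measure lborel K)"
      by (subst X[symmetric], subst nn_integral_distr) auto
    moreover have "(\<integral>\<^sup>+w. f (r * dist c (Y w)) \<partial>M) = (\<integral>\<^sup>+y. f (r * dist c y) \<partial>projective_distribution K c)" for r
      by (subst Y[symmetric], subst nn_integral_distr) auto
    ultimately show ?thesis using nn_integral_dist_center[OF K that] by simp
  qed
  have m [measurable]: "(\<lambda>w. dist (X w) (X' w)) \<in> borel_measurable M" "(\<lambda>w. dist (X w) (Y w)) \<in> borel_measurable M"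
    "(\<lambda>w. dist c (X w)) \<in> borel_measurable M" "(\<lambda>w. dist c (Y w)) \<in> borel_measurable M"
    by measurable
  have d: "0 < DIM('a)" "0 < 2 * DIM('a)" by simp_all
  \<comment> \<open>The mixed variable \<open>U\<close> is the distance to \<open>Y w\<close>, and
    \<open>W\<close> is the distance between the two uniform points or from \<open>c\<close> to one
    of them; the exponent is 2d in the first case and d in the second.\<close>
  note pairs_char = characteristic_function_power_mixture[OF assms(3) d(2) m(2,1) pairs]
  note centre_char = characteristic_function_power_mixture[OF assms(3) d(1) m(4,3) centre]
  show ?thesis
    using moment_power_mixture[OF assms(3) d(2) m(2,1) pairs]
      moment_power_mixture[OF assms(3) d(1) m(4,3) centre] pairs_char centre_char
    by simp
qed

end
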